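(* Let $n$ be a positive integer, let $\Phi:\bigcup_{k=1}^n(\mathbb N^* )^k\to\{1,\dots,n\}$ be a local matching criterion, i.e. a deterministic map with $\Phi(x_1,\dots,x_k)\in\{1,\dots,k\}$ for all $k$ and all $(x_1,\dots,x_k)\in(\mathbb N^* )^k$, and let $\xi^+,\xi^-$ be two probability measures on $\mathbb N$. Let $\mathbf d^+=(d^+(1),\dots,d^+(n))$ and $\mathbf d^-=(d^-(1),\dots,d^-(n))$ be two $n$-samples of $\xi^+$ and $\xi^-$ respectively, conditioned on $\sum_{i=1}^n d^+(i)=\sum_{i=1}^n d^-(i)$. Let $(\mu_t^+,\mu_t^-)_{0\le t\le n}$ be the measure-valued process of availabilities of the undetermined nodes in the joint construction of a multigraph and a matching, with criterion $\Phi$, from the degrees $\mathbf d^+,\mathbf d^-$. Then the process $\left((\mu_t^+,\mu_t^-),\ t\in\{0,1,\dots,n\}\right)$ is Markov.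
   Context: $\mathbb N$ is the set of non-negative integers, $\mathbb N^*=\mathbb N\setminus\{0\}$. The process takes values in $\mathcal M(\mathbb N)^2$, where $\mathcal M(\mathbb N)$ is the set of integer-valued finite measures on $\mathbb N$. All random draws mentioned below are independent of the past of the construction. **Joint construction of a multigraph and a matching from degrees $\mathbf d^+,\mathbf d^-$ with $\sum_i d^+(i)=\sum_i d^-(i)$.** The node set is $V=V^+\cup V^-$ with $V^\pm=\{v_1^\pm,\dots,v_n^\pm\}$. Start with undetermined sets $U_0^\pm=V^\pm$, availabilities (numbers of unpaired half-edges) $a_0(v_i^\pm)=d^\pm(i)$, and the edgeless graph on $V$. For $t=0,\dots,n-1$, given undetermined sets $U_t^\pm$ and availabilities $a_t(v)$, $v\in U_t=U_t^+\cup U_t^-$ (the total availability is always the same on both sides): - Choose $J^+$ uniformly at random in $U_t^+$. - If $a_t(J^+)>0$: pair the $a_t(J^+)$ half-edges of $J^+$ with $a_t(J^+)$ half-edges drawn uniformly at random without replacement among all available half-edges of the nodes of $U_t^-$ (node $v$ having $a_t(v)$ of them). Let $\{J_1^-,\dots,J_k^-\}$ be the distinct nodes of $U_t^-$ so reached and let $E_l^-\ge1$ be the number of drawn half-edges belonging to $J_l^-$, so that $J^+$ and $J^-_l$ are joined by $E^-_l$ edges. Draw a uniformly random permutation $\sigma\in\mathfrak S_k$, set $m=\Phi\big(a_t(J^-_{\sigma(1)}),\dots,a_t(J^-_{\sigma(k)})\big)$ and $J^-=J^-_{\sigma(m)}$ (the match of $J^+$). Then pair the remaining $a_t(J^-)-E^-_{\sigma(m)}$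 half-edges of $J^-$ (if any) with as many half-edges drawn uniformly at random without replacement among the available half-edges of the nodes of $U_t^+\setminus\{J^+\}$; let $J_1^+,\dots,J_\ell^+$ be the distinct nodes so reached and $E_l^+$ the number of drawn half-edges of $J_l^+$, so that $J_l^+$ and $J^-$ are joined by $E_l^+$ edges. All these edges are added to the multigraph. Set $U_{t+1}=U_t\setminus\{J^+,J^-\}$, $a_{t+1}(J_l^-)=a_t(J_l^-)-E_l^-$ for the $J_l^-\ne J^-$, $a_{t+1}(J_l^+)=a_t(J_l^+)-E_l^+$ for $1\le l\le\ell$, and $a_{t+1}(v)=a_t(v)$ for the other $v\in U_{t+1}$. - If $a_t(J^+)=0$: $J^+$ becomes isolated, $U_{t+1}=U_t\setminus\{J^+\}$, and no edges or availabilities of other nodes change. The associated measures are, for $0\le t\le n$, $$\mu_t^+=\sum_{v\in U_t^+}\delta_{a_t(v)},\qquad \mu_t^-=\sum_{v\in U_t^-}\delta_{a_t(v)}.$$ *)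

theory Defs
  imports "HOL-Probability.Probability" "HOL-Combinatorics.Permutations"
begin

definition local_matching_criterion :: "nat \<Rightarrow> (nat list \<Rightarrow> nat) \<Rightarrow> bool" where
  "local_matching_criterion n \<Phi> \<longleftrightarrow>
     (\<forall>xs. 1 \<le> length xs \<and> length xs \<le> n \<and> (\<forall>x\<in>set xs. 0 < x) \<longrightarrow> \<Phi> xs \<in> {1..length xs})"

text \<open>
  The nodes \<open>v\<^sub>i\<^sup>+\<close> and \<open>v\<^sub>i\<^sup>-\<close> are both represented by their index \<open>i\<close>; the side is given
  by the record field, or by the position in a pair: an edge or a match is a pair of a plus node
  and a minus node. Availabilities are only meaningful on the undetermined sets.
\<close>

record state =
  undet_pos :: "nat set"
  undet_neg :: "nat set"
  avail_pos :: "nat \<Rightarrow> nat"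
  avail_neg :: "nat \<Rightarrow> nat"
  edges :: "(nat \<times> nat) multiset"
  matching :: "(nat \<times> nat) set"

text \<open>A node \<open>v\<close> with availability \<open>a v\<close> carries the available half-edges \<open>(v, i)\<close>, \<open>i < a v\<close>.\<close>

definition half_edges :: "(nat \<Rightarrow> nat) \<Rightarrow> nat set \<Rightarrow> (nat \<times> nat) set" where
  "half_edges a U = (SIGMA v:U. {..<a v})"

definition draw_half_edges :: "nat \<Rightarrow> (nat \<Rightarrow> nat) \<Rightarrow> nat set \<Rightarrow> (nat \<times> nat) set pmf" where
  "draw_half_edges k a U = pmf_of_set {H. H \<subseteq> half_edges a U \<and> card H = k}"

definition multiplicity_in :: "(nat \<times> nat) set \<Rightarrow> nat \<Rightarrow> nat" where
  "multiplicity_in H v = card {h \<in> H. fst h = v}"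

text \<open>
  The list \<open>js\<close> enumerates the distinct nodes reached from \<open>J\<^sup>+\<close>. List positions start
  at \<open>0\<close> whereas the values of \<open>\<Phi>\<close> start at \<open>1\<close>.
\<close>

definition choose_match ::
    "(nat list \<Rightarrow> nat) \<Rightarrow> (nat \<Rightarrow> nat) \<Rightarrow> (nat \<times> nat) set \<Rightarrow> nat pmf" where
  "choose_match \<Phi> a H = do {
     let js = sorted_list_of_set (fst ` H);
     \<sigma> \<leftarrow> pmf_of_set {\<sigma>. \<sigma> permutes {..<length js}};
     let ks = permute_list \<sigma> js;
     return_pmf (ks ! (\<Phi> (map a ks) - 1))
   }"

definition step :: "(nat list \<Rightarrow> nat) \<Rightarrow> state \<Rightarrow> state pmf" where
  "step \<Phi> s = do {
     jp \<leftarrow> pmf_of_set (undet_pos s);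
     if avail_pos s jp = 0 then return_pmf (s\<lparr>undet_pos := undet_pos s - {jp}\<rparr>)
     else do {
       Hm \<leftarrow> draw_half_edges (avail_pos s jp) (avail_neg s) (undet_neg s);
       jm \<leftarrow> choose_match \<Phi> (avail_neg s) Hm;
       Hp \<leftarrow> draw_half_edges (avail_neg s jm - multiplicity_in Hm jm) (avail_pos s)
               (undet_pos s - {jp});
       return_pmf
         \<lparr>undet_pos = undet_pos s - {jp},
          undet_neg = undet_neg s - {jm},
          avail_pos = (\<lambda>v. avail_pos s v - multiplicity_in Hp v),
          avail_neg = (\<lambda>v. avail_neg s v - multiplicity_in Hm v),
          edges = edges s + image_mset (\<lambda>h. (jp, fst h)) (mset_set Hm)
                          + image_mset (\<lambda>h. (fst h, jm)) (mset_set Hp),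
          matching = insert (jp, jm) (matching s)\<rparr>
     }
   }"

definition initial_state :: "nat \<Rightarrow> (nat \<Rightarrow> nat) \<Rightarrow> (nat \<Rightarrow> nat) \<Rightarrow> state" where
  "initial_state n dp dm =
     \<lparr>undet_pos = {1..n}, undet_neg = {1..n}, avail_pos = dp, avail_neg = dm,
      edges = {#}, matching = {}\<rparr>"

primrec run :: "(nat list \<Rightarrow> nat) \<Rightarrow> nat \<Rightarrow> state \<Rightarrow> state list pmf" where
  "run \<Phi> 0 s = return_pmf [s]"
| "run \<Phi> (Suc k) s = do {
     s' \<leftarrow> step \<Phi> s;
     ss \<leftarrow> run \<Phi> k s';
     return_pmf (s # ss)
   }"

text \<open>
  Pairs of independent samples of sizes \<open>n\<close>, as functions that vanish outside \<open>{1..n}\<close>.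
\<close>

definition sample_law :: "nat \<Rightarrow> nat pmf \<Rightarrow> nat pmf \<Rightarrow> ((nat \<Rightarrow> nat) \<times> (nat \<Rightarrow> nat)) pmf" where
  "sample_law n \<xi>p \<xi>m = pair_pmf (Pi_pmf {1..n} 0 (\<lambda>_. \<xi>p)) (Pi_pmf {1..n} 0 (\<lambda>_. \<xi>m))"

definition balanced :: "nat \<Rightarrow> ((nat \<Rightarrow> nat) \<times> (nat \<Rightarrow> nat)) set" where
  "balanced n = {(dp, dm). (\<Sum>i=1..n. dp i) = (\<Sum>i=1..n. dm i)}"

text \<open>The law of the whole trajectory; the state at time \<open>t\<close> is the list entry at position \<open>t\<close>.\<close>

definition construction_law ::
    "nat \<Rightarrow> (nat list \<Rightarrow> nat) \<Rightarrow> nat pmf \<Rightarrow> nat pmf \<Rightarrow> state list pmf" where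
  "construction_law n \<Phi> \<xi>p \<xi>m = do {
     (dp, dm) \<leftarrow> cond_pmf (sample_law n \<xi>p \<xi>m) (balanced n);
     run \<Phi> n (initial_state n dp dm)
   }"

text \<open>The sum of the Dirac measures at \<open>a v\<close> for \<open>v \<in> U\<close>, as a push-forward.\<close>

definition avail_measure :: "nat set \<Rightarrow> (nat \<Rightarrow> nat) \<Rightarrow> nat measure" where
  "avail_measure U a = distr (count_space U) (count_space UNIV) a"

lemma sets_avail_measure [simp]: "sets (avail_measure U a) = UNIV"
  by (simp add: avail_measure_def)

lemma emeasure_avail_measure:
  assumes "finite U"
  shows "emeasure (avail_measure U a) A = (\<Sum>v\<in>U. emeasure (return (count_space UNIV) (a v)) A)"
proof -
  have "emeasure (avail_measure U a) A = of_nat (card {v \<in> U. a v \<in> A})"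
    using assms unfolding avail_measure_def
    by (subst emeasure_distr) (auto simp: vimage_def Int_def conj_commute)
  also have "\<dots> = (\<Sum>v\<in>U. indicator A (a v))"
    using assms by (simp add: indicator_def sum.If_cases Int_def)
  finally show ?thesis by simp
qed

definition availabilities :: "state \<Rightarrow> nat measure \<times> nat measure" where
  "availabilities s =
     (avail_measure (undet_pos s) (avail_pos s), avail_measure (undet_neg s) (avail_neg s))"

text \<open>
  The Markov property of \<open>X 0, \<dots>, X n\<close>. On a discrete probability space, the random
  variables take countably many values almost surely, so that elementary conditioning suffices.
\<close>

definition markov_process :: "'w pmf \<Rightarrow> nat \<Rightarrow> (nat \<Rightarrow> 'w \<Rightarrow> 's) \<Rightarrow> bool" where
  "markov_process p n X \<longleftrightarrow>
     (\<forall>t<n. \<forall>x y. \<P>(\<omega> in measure_pmf p. \<forall>s\<le>t. X s \<omega> = x s) > 0 \<longrightarrow>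
        \<P>(\<omega> in measure_pmf p. X (Suc t) \<omega> = y \<bar> \<forall>s\<le>t. X s \<omega> = x s) =
        \<P>(\<omega> in measure_pmf p. X (Suc t) \<omega> = y \<bar> X t \<omega> = x t))"

end

theory Submission
  imports Defs
begin

text \<open>
  The sequence of states of the construction is by definition a Markov chain, and the measures
  are a function of the state. A function of a Markov chain need not be Markov, but it is, for every
  initial law, if states with the same image have the same law for the image of their successor.

  This condition holds because the construction treats nodes anonymously. Two states with equal
  measures have, on each side, equally many undetermined nodes of every availability, so one is
  obtained from the other by a bijection of the plus nodes and a bijection of the minus nodes that
  preserve availabilities (\<open>avail_measure_eqD\<close>). Such a relabelling carries each random choice of
  one state to the corresponding choice of the other: the uniform plus node, the uniform draws of
  half-edges (\<open>draw_half_edges_relabel\<close>), and the match (\<open>choose_match_relabel\<close>). For the match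
  it matters that the reached nodes are shuffled before the criterion is applied and that the
  criterion reads only availabilities; the names of the nodes then have no influence. The two
  successors are again relabellings of each other on the undetermined nodes
  (\<open>step_relabel\<close>), hence have equal measures.

  A uniform choice is meaningful only from a nonempty set. The comparison is therefore restricted to
  admissible states, in which both sides have the same total availability. The conditioning on equal
  degree sums provides this at time 0, and \<open>admissible_step\<close> propagates it.

  Finally, both conditional probabilities in the Markov property are computed by
  \<open>prob_next_availabilities\<close>. Conditioning on any event of the past that fixes the
  current measures gives the same transition probability, so the whole past and the present alone
  lead to the same value.
\<close>

section \<open>Drawing half-edges\<close>

lemma finite_half_edges [simp]: "finite U \<Longrightarrow> finite (half_edges a U)"
  by (simp add: half_edges_def)

lemma card_half_edges: "finite U \<Longrightarrow> card (half_edges a U) = (\<Sum>v\<in>U. a v)"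
  by (simp add: half_edges_def)

lemma fst_half_edges: "H \<subseteq> half_edges a U \<Longrightarrow> fst ` H \<subseteq> U"
  by (auto simp: half_edges_def)

lemma avail_pos_of_reached: "H \<subseteq> half_edges a U \<Longrightarrow> v \<in> fst ` H \<Longrightarrow> 0 < a v"
  by (force simp: half_edges_def)

lemma finite_draws:
  "finite U \<Longrightarrow> finite {H. H \<subseteq> half_edges a U \<and> card H = k}"
  by (rule finite_subset[of _ "Pow (half_edges a U)"]) auto

text \<open>
  A uniform draw is a meaningful law only if there is something to draw from. This is why the
  demand \<open>k\<close> has to be compared with the total availability, here and in all later
  statements on \<^const>\<open>draw_half_edges\<close>.
\<close>

lemma draws_nonempty:
  assumes "finite U" and "k \<le> (\<Sum>v\<in>U. a v)"
  shows "{H. H \<subseteq> half_edges a U \<and> card H = k} \<noteq> {}"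
proof -
  obtain H where "H \<subseteq> half_edges a U" "card H = k"
    using assms by (metis card_half_edges obtain_subset_with_card_n)
  then show ?thesis by blast
qed

lemma set_draw_half_edges:
  assumes "finite U" and "k \<le> (\<Sum>v\<in>U. a v)"
  shows "set_pmf (draw_half_edges k a U) = {H. H \<subseteq> half_edges a U \<and> card H = k}"
  unfolding draw_half_edges_def
  by (rule set_pmf_of_set[OF draws_nonempty[OF assms] finite_draws[OF assms(1)]])

lemma multiplicity_le_avail:
  assumes "H \<subseteq> half_edges a U"
  shows "multiplicity_in H v \<le> a v"
proof -
  have "{h \<in> H. fst h = v} \<subseteq> Pair v ` {..<a v}"
    using assms by (auto simp: half_edges_def)
  then have "multiplicity_in H v \<le> card (Pair v ` {..<a v})"
    unfolding multiplicity_in_def by (intro card_mono) auto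
  also have "\<dots> \<le> a v"
    using card_image_le[of "{..<a v}" "Pair v"] by simp
  finally show ?thesis .
qed

lemma sum_multiplicity:
  assumes "finite U" and "H \<subseteq> half_edges a U"
  shows "(\<Sum>v\<in>U. multiplicity_in H v) = card H"
proof -
  have fin: "finite H"
    using assms finite_half_edges finite_subset by blast
  have "H = (\<Union>v\<in>U. {h \<in> H. fst h = v})"
    using assms(2) by (auto simp: half_edges_def)
  then have "card H = card (\<Union>v\<in>U. {h \<in> H. fst h = v})"
    by simp
  also have "\<dots> = (\<Sum>v\<in>U. card {h \<in> H. fst h = v})"
    using assms(1) fin by (intro card_UN_disjoint) auto
  finally show ?thesis
    by (simp add: multiplicity_in_def)
qed

lemma sum_remaining_avail:
  assumes "finite U" and "H \<subseteq> half_edges a U"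
  shows "(\<Sum>v\<in>U. a v - multiplicity_in H v) = (\<Sum>v\<in>U. a v) - card H"
  using sum_subtractf_nat[of U "multiplicity_in H" a] multiplicity_le_avail[OF assms(2)]
  by (simp add: sum_multiplicity[OF assms])

section \<open>Choosing the match\<close>

text \<open>
  A uniformly shuffled list forgets its original order, so that its law depends only on the set
  of its elements. The map \<open>\<sigma> \<mapsto> permute_list \<sigma> xs\<close> is injective because the entries of
  \<open>xs\<close> are distinct, and it is onto because both sides have \<open>fact (length xs)\<close> elements.
\<close>

lemma map_permute_list_pmf_of_set:
  assumes "distinct xs"
  shows "map_pmf (\<lambda>\<sigma>. permute_list \<sigma> xs) (pmf_of_set {\<sigma>. \<sigma> permutes {..<length xs}}) =
    pmf_of_set (permutations_of_set (set xs))"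
proof (rule map_pmf_of_set_bij_betw)
  let ?P = "{\<sigma>. \<sigma> permutes {..<length xs}}"
  let ?f = "\<lambda>\<sigma>. permute_list \<sigma> xs"
  show fin: "finite ?P" and "?P \<noteq> {}"
    using permutes_id by (auto simp: finite_permutations intro: exI[of _ id])
  have inj: "inj_on ?f ?P"
  proof (rule inj_onI)
    fix \<sigma> \<tau> assume *: "\<sigma> \<in> ?P" "\<tau> \<in> ?P" "?f \<sigma> = ?f \<tau>"
    have "\<sigma> i = \<tau> i" for i
    proof (cases "i < length xs")
      case True
      then have "xs ! \<sigma> i = xs ! \<tau> i"
        using * permute_list_nth[of _ xs i] by (metis mem_Collect_eq)
      moreover have "\<sigma> i < length xs" "\<tau> i < length xs"
        using * True permutes_in_image by fastforce+
      ultimately show ?thesis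
        using assms nth_eq_iff_index_eq by blast
    next
      case False
      then show ?thesis
        using * by (simp add: permutes_not_in)
    qed
    then show "\<sigma> = \<tau>" by blast
  qed
  have "?f ` ?P = permutations_of_set (set xs)"
  proof (rule card_subset_eq)
    show "?f ` ?P \<subseteq> permutations_of_set (set xs)"
      using assms by (auto intro!: permutations_of_setI)
    show "card (?f ` ?P) = card (permutations_of_set (set xs))"
      using card_image[OF inj] card_permutations[of "{..<length xs}" "length xs"]
      by (simp add: distinct_card[OF assms])
  qed simp
  with inj show "bij_betw ?f ?P (permutations_of_set (set xs))"
    by (simp add: bij_betw_def)
qed

text \<open>
  This form of the choice no longer mentions the increasing enumeration of the reached nodes, which
  a relabelling would not preserve.
\<close>

lemma choose_match_eq:
  assumes "finite H"
  shows "choose_match \<Phi> a H =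
    map_pmf (\<lambda>ks. ks ! (\<Phi> (map a ks) - 1)) (pmf_of_set (permutations_of_set (fst ` H)))"
proof -
  let ?js = "sorted_list_of_set (fst ` H)"
  have "pmf_of_set (permutations_of_set (fst ` H)) =
      map_pmf (\<lambda>\<sigma>. permute_list \<sigma> ?js) (pmf_of_set {\<sigma>. \<sigma> permutes {..<length ?js}})"
    using map_permute_list_pmf_of_set[of ?js] assms by simp
  then show ?thesis
    unfolding choose_match_def Let_def by (simp only: map_pmf_comp map_pmf_def[symmetric])
qed

text \<open>
  The criterion is applied to a list that is nonempty, no longer than \<open>n\<close> and free
  of zeros, since a node without half-edges is never reached. Hence its value is a
  valid position of the list, and the match is one of the reached nodes.
\<close>

lemma match_index_less:
  assumes "local_matching_criterion n \<Phi>" and "finite U" and "card U \<le> n"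
    and "H \<subseteq> half_edges a U" and "H \<noteq> {}" and "ks \<in> permutations_of_set (fst ` H)"
  shows "\<Phi> (map a ks) - 1 < length ks"
proof -
  have ks: "set ks = fst ` H" "distinct ks"
    using permutations_of_setD[OF assms(6)] by auto
  have "length ks \<le> card U"
    using ks fst_half_edges[OF assms(4)] assms(2) by (metis card_mono distinct_card)
  moreover have "1 \<le> length ks"
    using ks assms(5) by (cases ks) auto
  moreover have "\<forall>x\<in>set (map a ks). 0 < x"
    using ks avail_pos_of_reached[OF assms(4)] by auto
  ultimately have "\<Phi> (map a ks) \<in> {1..length (map a ks)}"
    using assms(1,3) unfolding local_matching_criterion_def
    by (metis (no_types, lifting) length_map order_trans)
  then show ?thesis by auto
qed

lemma set_choose_match:
  assumes "local_matching_criterion n \<Phi>" and "finite U" and "card U \<le> n"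
    and "H \<subseteq> half_edges a U" and "H \<noteq> {}"
  shows "set_pmf (choose_match \<Phi> a H) \<subseteq> fst ` H"
proof
  have fin: "finite H"
    using assms finite_half_edges finite_subset by blast
  fix j assume "j \<in> set_pmf (choose_match \<Phi> a H)"
  then obtain ks where "ks \<in> permutations_of_set (fst ` H)" "j = ks ! (\<Phi> (map a ks) - 1)"
    using fin by (auto simp: choose_match_eq)
  then show "j \<in> fst ` H"
    using match_index_less[OF assms] by (metis nth_mem permutations_of_setD(1))
qed

section \<open>Relabelling the nodes\<close>

lemma half_edges_relabel:
  assumes "\<And>v. v \<in> U \<Longrightarrow> b (f v) = a v"
  shows "half_edges b (f ` U) = map_prod f id ` half_edges a U"
  using assms by (force simp: half_edges_def)

text \<open>
  A relabelling of the nodes that respects the availabilities maps half-edges bijectively onto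
  half-edges, hence draws onto draws, and a uniform law is carried to the uniform law by a bijection.
\<close>

lemma draw_half_edges_relabel:
  assumes "finite U" and "k \<le> (\<Sum>v\<in>U. a v)" and "inj_on f U"
    and "\<And>v. v \<in> U \<Longrightarrow> b (f v) = a v"
  shows "draw_half_edges k b (f ` U) = map_pmf (image (map_prod f id)) (draw_half_edges k a U)"
proof -
  let ?F = "map_prod f id :: nat \<times> nat \<Rightarrow> nat \<times> nat"
  let ?E = "half_edges a U"
  have inj: "inj_on ?F ?E"
    using assms(3) by (fastforce simp: inj_on_def half_edges_def)
  have injP: "inj_on (image ?F) {H. H \<subseteq> ?E \<and> card H = k}"
    using inj_on_image_Pow[OF inj] by (rule inj_on_subset) auto
  have "{H. H \<subseteq> ?F ` ?E \<and> card H = k} = image ?F ` {H. H \<subseteq> ?E \<and> card H = k}"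
  proof (intro equalityI subsetI)
    fix H assume H: "H \<in> {H. H \<subseteq> ?F ` ?E \<and> card H = k}"
    then obtain G where "G \<subseteq> ?E" "H = ?F ` G"
      by (auto simp: subset_image_iff)
    moreover have "card (?F ` G) = card G"
      using card_image inj_on_subset[OF inj \<open>G \<subseteq> ?E\<close>] by blast
    ultimately show "H \<in> image ?F ` {H. H \<subseteq> ?E \<and> card H = k}"
      using H by auto
  next
    fix H assume "H \<in> image ?F ` {H. H \<subseteq> ?E \<and> card H = k}"
    then show "H \<in> {H. H \<subseteq> ?F ` ?E \<and> card H = k}"
      by (auto simp: card_image inj_on_subset[OF inj])
  qed
  moreover have "half_edges b (f ` U) = ?F ` ?E"
    using assms(4) by (rule half_edges_relabel)
  ultimately show ?thesis
    unfolding draw_half_edges_def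
    using map_pmf_of_set_inj[OF injP draws_nonempty[OF assms(1,2)] finite_draws[OF assms(1)]]
    by simp
qed

lemma multiplicity_relabel:
  assumes "inj_on f U" and "fst ` H \<subseteq> U" and "v \<in> U"
  shows "multiplicity_in (map_prod f id ` H) (f v) = multiplicity_in H v"
proof -
  have "f (fst h) = f v \<longleftrightarrow> fst h = v" if "h \<in> H" for h
    using assms that by (metis image_subset_iff inj_on_eq_iff)
  then have "{h \<in> map_prod f id ` H. fst h = f v} = map_prod f id ` {h \<in> H. fst h = v}"
    by auto
  moreover have "inj_on (map_prod f id) {h \<in> H. fst h = v}"
    by (auto simp: inj_on_def)
  ultimately show ?thesis
    by (simp add: multiplicity_in_def card_image)
qed

text \<open>
  The criterion sees only the availabilities of the listed nodes, and these are the same for a list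
  and its relabelling. So both lists select the same position.
\<close>

lemma choose_match_relabel:
  assumes "local_matching_criterion n \<Phi>" and "finite U" and "card U \<le> n"
    and "H \<subseteq> half_edges a U" and "H \<noteq> {}" and "inj_on f U"
    and "\<And>v. v \<in> U \<Longrightarrow> b (f v) = a v"
  shows "choose_match \<Phi> b (map_prod f id ` H) = map_pmf f (choose_match \<Phi> a H)"
proof -
  have fin: "finite H"
    using assms finite_half_edges finite_subset by blast
  have sub: "fst ` H \<subseteq> U"
    by (rule fst_half_edges[OF assms(4)])
  have inj: "inj_on f (fst ` H)"
    using assms(6) sub by (rule inj_on_subset)
  have img: "fst ` map_prod f id ` H = f ` fst ` H"
    by (auto simp: image_image)
  have "inj_on (map f) (permutations_of_set (fst ` H))"
    using inj by (auto intro!: inj_onI dest!: permutations_of_setD(1) simp: inj_on_map_eq_map)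
  then have perm: "pmf_of_set (permutations_of_set (f ` fst ` H)) =
      map_pmf (map f) (pmf_of_set (permutations_of_set (fst ` H)))"
    unfolding permutations_of_set_image_inj[OF inj]
    using fin by (intro map_pmf_of_set_inj[symmetric]) auto
  have "map f ks ! (\<Phi> (map b (map f ks)) - 1) = f (ks ! (\<Phi> (map a ks) - 1))"
    if "ks \<in> permutations_of_set (fst ` H)" for ks
  proof -
    have "map b (map f ks) = map a ks"
      using permutations_of_setD(1)[OF that] sub assms(7) by auto
    then show ?thesis
      using match_index_less[OF assms(1-5) that] by (simp only: nth_map)
  qed
  then show ?thesis
    using fin unfolding choose_match_eq[OF fin] choose_match_eq[OF finite_imageI[OF fin]] img perm
      map_pmf_comp
    by (intro map_pmf_cong) auto
qed

lemma avail_measure_relabel: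
  assumes "finite U" and "inj_on f U" and "\<And>v. v \<in> U \<Longrightarrow> b (f v) = a v"
  shows "avail_measure (f ` U) b = avail_measure U a"
proof (rule measure_eqI)
  fix A
  show "emeasure (avail_measure (f ` U) b) A = emeasure (avail_measure U a) A"
    using assms by (simp add: emeasure_avail_measure sum.reindex)
qed simp

text \<open>
  The mass at \<open>x\<close> counts the nodes of availability \<open>x\<close>. Thus the measure determines how many
  nodes have each availability, although it does not say which ones.
\<close>

lemma card_fibre_eq_emeasure:
  assumes "finite U"
  shows "of_nat (card {v \<in> U. a v = x}) = emeasure (avail_measure U a) {x}"
  using assms by (simp add: emeasure_avail_measure indicator_def sum.If_cases Int_def)

text \<open>
  Converse of \<open>avail_measure_relabel\<close>: the nodes of a given availability \<open>x\<close> are equally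
  many in \<open>U\<close> and \<open>V\<close>, and bijections between these fibres can be glued together.
\<close>

lemma avail_measure_eqD:
  assumes "finite U" and "finite V" and "avail_measure U a = avail_measure V b"
  obtains f where "bij_betw f U V" and "\<And>v. v \<in> U \<Longrightarrow> b (f v) = a v"
proof -
  have "of_nat (card {v \<in> U. a v = x}) = (of_nat (card {v \<in> V. b v = x}) :: ennreal)" for x
    using assms by (simp add: card_fibre_eq_emeasure)
  then have "card {v \<in> U. a v = x} = card {v \<in> V. b v = x}" for x
    by simp
  then have "\<exists>h. bij_betw h {v \<in> U. a v = x} {v \<in> V. b v = x}" for x
    using assms by (intro finite_same_card_bij) auto
  then obtain h where h: "\<And>x. bij_betw (h x) {v \<in> U. a v = x} {v \<in> V. b v = x}"
    by metis
  have h_in: "h (a v) v \<in> V \<and> b (h (a v) v) = a v" if "v \<in> U" for v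
    using bij_betwE[OF h[of "a v"]] that by blast
  show thesis
  proof
    show "bij_betw (\<lambda>v. h (a v) v) U V"
      unfolding bij_betw_def
    proof
      show "inj_on (\<lambda>v. h (a v) v) U"
      proof (rule inj_onI)
        fix v w assume vw: "v \<in> U" "w \<in> U" "h (a v) v = h (a w) w"
        then have "a v = a w"
          using h_in by metis
        then show "v = w"
          using vw bij_betw_imp_inj_on[OF h[of "a v"]] by (auto dest: inj_onD)
      qed
      show "(\<lambda>v. h (a v) v) ` U = V"
      proof
        show "(\<lambda>v. h (a v) v) ` U \<subseteq> V"
          using h_in by blast
        show "V \<subseteq> (\<lambda>v. h (a v) v) ` U"
        proof
          fix w assume "w \<in> V"
          then have "w \<in> h (b w) ` {v \<in> U. a v = b w}"
            using bij_betw_imp_surj_on[OF h[of "b w"]] by blast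
          then obtain v where "v \<in> U" "a v = b w" "w = h (b w) v"
            by blast
          then show "w \<in> (\<lambda>v. h (a v) v) ` U"
            by (intro image_eqI[of _ _ v]) simp_all
        qed
      qed
    qed
    show "b (h (a v) v) = a v" if "v \<in> U" for v
      using h_in that by blast
  qed
qed

section \<open>One step of the construction\<close>

text \<open>
  The invariant that makes every draw of the construction possible. The number \<open>r\<close> is that of
  the steps still to come: each step determines exactly one plus node, whereas a minus node is
  determined only if the plus node has an available half-edge. The bound \<open>n\<close> on the minus
  nodes keeps the lists shown to the criterion within its domain.
\<close>

definition admissible :: "nat \<Rightarrow> nat \<Rightarrow> state \<Rightarrow> bool" where
  "admissible n r s \<longleftrightarrow>
     finite (undet_pos s) \<and> card (undet_pos s) = r \<and>
     finite (undet_neg s) \<and> card (undet_neg s) \<le> n \<and>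
     (\<Sum>v\<in>undet_pos s. avail_pos s v) = (\<Sum>v\<in>undet_neg s. avail_neg s v)"

text \<open>
  Once \<open>i\<close> has been served, balance says that the other plus nodes have as many half-edges as
  all the minus nodes have left, and those left at \<open>j\<close> are among the latter.
\<close>

lemma second_draw_feasible:
  assumes "finite P" and "finite M" and "(\<Sum>v\<in>P. a v) = (\<Sum>v\<in>M. b v)"
    and "i \<in> P" and "j \<in> M" and "H \<subseteq> half_edges b M" and "card H = a i"
  shows "b j - multiplicity_in H j \<le> (\<Sum>v\<in>P - {i}. a v)"
proof -
  have "b j - multiplicity_in H j \<le> (\<Sum>v\<in>M. b v - multiplicity_in H v)"
    using assms by (intro member_le_sum) auto
  also have "\<dots> = (\<Sum>v\<in>P - {i}. a v)"
    using assms by (simp add: sum_remaining_avail sum_diff1_nat)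
  finally show ?thesis .
qed

text \<open>
  The only point is balance. The total availability on the plus side drops by that of \<open>i\<close> and by
  the number of half-edges drawn for the match \<open>j\<close>. On the minus side the first draw removes as
  many half-edges as \<open>i\<close> has, and the removal of \<open>j\<close> discards those that \<open>j\<close> had left,
  which is exactly the size of the second draw.
\<close>

lemma admissible_step:
  assumes crit: "local_matching_criterion n \<Phi>" and adm: "admissible n (Suc r) s"
    and s': "s' \<in> set_pmf (step \<Phi> s)"
  shows "admissible n r s'"
proof -
  let ?P = "undet_pos s" and ?M = "undet_neg s" and ?a = "avail_pos s" and ?b = "avail_neg s"
  have fin: "finite ?P" "finite ?M" and card: "card ?P = Suc r" "card ?M \<le> n"
    and bal: "(\<Sum>v\<in>?P. ?a v) = (\<Sum>v\<in>?M. ?b v)"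
    using adm by (auto simp: admissible_def)
  have ne: "?P \<noteq> {}"
    using card by auto
  obtain i where i: "i \<in> ?P" and s'_i: "s' \<in> set_pmf
      (if ?a i = 0 then return_pmf (s\<lparr>undet_pos := ?P - {i}\<rparr>)
       else do {
         Hm \<leftarrow> draw_half_edges (?a i) ?b ?M;
         jm \<leftarrow> choose_match \<Phi> ?b Hm;
         Hp \<leftarrow> draw_half_edges (?b jm - multiplicity_in Hm jm) ?a (?P - {i});
         return_pmf
           \<lparr>undet_pos = ?P - {i}, undet_neg = ?M - {jm},
            avail_pos = (\<lambda>v. ?a v - multiplicity_in Hp v),
            avail_neg = (\<lambda>v. ?b v - multiplicity_in Hm v),
            edges = edges s + image_mset (\<lambda>h. (i, fst h)) (mset_set Hm)
                            + image_mset (\<lambda>h. (fst h, jm)) (mset_set Hp),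
            matching = insert (i, jm) (matching s)\<rparr>
       })"
    using s' unfolding step_def set_bind_pmf UN_iff set_pmf_of_set[OF ne fin(1)] by blast
  show ?thesis
  proof (cases "?a i = 0")
    case True
    then show ?thesis
      using s'_i i fin card bal by (simp add: admissible_def sum_diff1_nat)
  next
    case False
    have "?a i \<le> (\<Sum>v\<in>?M. ?b v)"
      using i fin by (simp add: bal[symmetric] member_le_sum)
    then obtain H j G where H: "H \<subseteq> half_edges ?b ?M" "card H = ?a i"
      and j: "j \<in> set_pmf (choose_match \<Phi> ?b H)"
      and G: "G \<in> set_pmf (draw_half_edges (?b j - multiplicity_in H j) ?a (?P - {i}))"
      and eqs: "undet_pos s' = ?P - {i}" "undet_neg s' = ?M - {j}"
        "avail_pos s' = (\<lambda>v. ?a v - multiplicity_in G v)"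
        "avail_neg s' = (\<lambda>v. ?b v - multiplicity_in H v)"
      using s'_i False fin by (auto simp: set_draw_half_edges)
    have "H \<noteq> {}"
      using H False by auto
    then have "j \<in> ?M"
      using set_choose_match[OF crit fin(2) card(2) H(1)] j fst_half_edges[OF H(1)] by blast
    have G': "G \<subseteq> half_edges ?a (?P - {i})" "card G = ?b j - multiplicity_in H j"
      using G fin second_draw_feasible[OF fin bal i \<open>j \<in> ?M\<close> H] by (auto simp: set_draw_half_edges)
    have "(\<Sum>v\<in>?P - {i}. ?a v - multiplicity_in G v) =
        (\<Sum>v\<in>?P. ?a v) - ?a i - (?b j - multiplicity_in H j)"
      using fin i G'(2) sum_diff1_nat[of ?a ?P i] sum_remaining_avail[OF _ G'(1)] by simp
    also have "\<dots> = (\<Sum>v\<in>?M. ?b v - multiplicity_in H v) - (?b j - multiplicity_in H j)"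
      using fin H by (simp add: sum_remaining_avail bal)
    also have "\<dots> = (\<Sum>v\<in>?M - {j}. ?b v - multiplicity_in H v)"
      using fin \<open>j \<in> ?M\<close> by (simp add: sum_diff1_nat)
    finally show ?thesis
      using fin card i \<open>j \<in> ?M\<close> by (simp add: admissible_def eqs)
  qed
qed

lemma availabilities_relabel:
  assumes "finite (undet_pos s)" and "finite (undet_neg s)"
    and "undet_pos s' = f ` undet_pos s" and "undet_neg s' = g ` undet_neg s"
    and "inj_on f (undet_pos s)" and "inj_on g (undet_neg s)"
    and "\<And>v. v \<in> undet_pos s \<Longrightarrow> avail_pos s' (f v) = avail_pos s v"
    and "\<And>v. v \<in> undet_neg s \<Longrightarrow> avail_neg s' (g v) = avail_neg s v"
  shows "availabilities s' = availabilities s"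
  using assms by (simp add: availabilities_def avail_measure_relabel)

text \<open>
  Every random choice in the second state is the image, under the relabelling, of the corresponding
  choice in the first. The two steps can therefore be compared draw by draw, and the resulting states
  again differ by a relabelling. Only the undetermined nodes have to correspond, because they are all
  that a step and \<^const>\<open>availabilities\<close> look at.
\<close>

lemma step_relabel:
  assumes crit: "local_matching_criterion n \<Phi>" and adm: "admissible n (Suc r) s"
    and undet: "undet_pos s' = f ` undet_pos s" "undet_neg s' = g ` undet_neg s"
    and inj: "inj_on f (undet_pos s)" "inj_on g (undet_neg s)"
    and avail_p: "\<And>v. v \<in> undet_pos s \<Longrightarrow> avail_pos s' (f v) = avail_pos s v"
    and avail_m: "\<And>v. v \<in> undet_neg s \<Longrightarrow> avail_neg s' (g v) = avail_neg s v"
  shows "map_pmf availabilities (step \<Phi> s') = map_pmf availabilities (step \<Phi> s)"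
proof -
  let ?P = "undet_pos s" and ?M = "undet_neg s" and ?a = "avail_pos s" and ?b = "avail_neg s"
  let ?F = "map_prod f id :: nat \<times> nat \<Rightarrow> nat \<times> nat"
  let ?G = "map_prod g id :: nat \<times> nat \<Rightarrow> nat \<times> nat"
  have fin: "finite ?P" "finite ?M" and card: "card ?P = Suc r" "card ?M \<le> n"
    and bal: "(\<Sum>v\<in>?P. ?a v) = (\<Sum>v\<in>?M. ?b v)"
    using adm by (auto simp: admissible_def)
  have ne: "?P \<noteq> {}"
    using card by auto
  have first: "pmf_of_set (undet_pos s') = map_pmf f (pmf_of_set ?P)"
    unfolding undet by (rule map_pmf_of_set_inj[OF inj(1) ne fin(1), symmetric])
  show ?thesis
    unfolding step_def first map_bind_pmf bind_map_pmf
  proof (rule bind_pmf_cong[OF refl], goal_cases)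
    case (1 i)
    then have i: "i \<in> ?P"
      using ne fin by simp
    have ai: "avail_pos s' (f i) = ?a i"
      using i by (rule avail_p)
    have remove_i: "undet_pos s' - {f i} = f ` (?P - {i})"
      using i inj(1) by (auto simp: undet inj_on_def)
    have inj_i: "inj_on f (?P - {i})"
      using inj(1) by (rule inj_on_subset) blast
    show ?case
    proof (cases "?a i = 0")
      case True
      have "availabilities (s'\<lparr>undet_pos := f ` (?P - {i})\<rparr>) =
          availabilities (s\<lparr>undet_pos := ?P - {i}\<rparr>)"
        by (rule availabilities_relabel[where f = f and g = g])
          (use fin undet inj inj_i avail_p avail_m in auto)
      then show ?thesis
        by (simp add: ai True remove_i)
    next
      case False
      have le: "?a i \<le> (\<Sum>v\<in>?M. ?b v)"
        using i fin by (simp add: bal[symmetric] member_le_sum)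
      have draw: "draw_half_edges (?a i) (avail_neg s') (undet_neg s') =
          map_pmf (image ?G) (draw_half_edges (?a i) ?b ?M)"
        unfolding undet by (rule draw_half_edges_relabel[OF fin(2) le inj(2) avail_m])
      show ?thesis
        unfolding ai if_not_P[OF False] draw map_bind_pmf bind_map_pmf
      proof (rule bind_pmf_cong[OF refl], goal_cases)
        case (1 H)
        then have H: "H \<subseteq> half_edges ?b ?M" "card H = ?a i"
          by (auto simp: set_draw_half_edges[OF fin(2) le])
        then have "H \<noteq> {}"
          using False by auto
        have match: "choose_match \<Phi> (avail_neg s') (?G ` H) =
            map_pmf g (choose_match \<Phi> ?b H)"
          by (rule choose_match_relabel[OF crit fin(2) card(2) H(1) \<open>H \<noteq> {}\<close> inj(2) avail_m])
        have mult_H: "multiplicity_in (?G ` H) (g v) = multiplicity_in H v" if "v \<in> ?M" for v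
          by (rule multiplicity_relabel[OF inj(2) fst_half_edges[OF H(1)] that])
        show ?case
          unfolding match bind_map_pmf
        proof (rule bind_pmf_cong[OF refl], goal_cases)
          case (1 j)
          then have j: "j \<in> ?M"
            using set_choose_match[OF crit fin(2) card(2) H(1) \<open>H \<noteq> {}\<close>]
              fst_half_edges[OF H(1)] by blast
          have remove_j: "undet_neg s' - {g j} = g ` (?M - {j})"
            using j inj(2) by (auto simp: undet inj_on_def)
          have inj_j: "inj_on g (?M - {j})"
            using inj(2) by (rule inj_on_subset) blast
          let ?k = "?b j - multiplicity_in H j"
          have k: "avail_neg s' (g j) - multiplicity_in (?G ` H) (g j) = ?k"
            using j by (simp add: avail_m mult_H)
          have le_k: "?k \<le> (\<Sum>v\<in>?P - {i}. ?a v)"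
            by (rule second_draw_feasible[OF fin bal i j H])
          have fin_i: "finite (?P - {i})"
            using fin by simp
          have draw': "draw_half_edges ?k (avail_pos s') (f ` (?P - {i})) =
              map_pmf (image ?F) (draw_half_edges ?k ?a (?P - {i}))"
            using avail_p by (intro draw_half_edges_relabel[OF fin_i le_k inj_i]) auto
          show ?case
            unfolding k remove_i draw' bind_map_pmf map_return_pmf
          proof (rule bind_pmf_cong[OF refl], goal_cases)
            case (1 K)
            then have K: "K \<subseteq> half_edges ?a (?P - {i})"
              by (auto simp: set_draw_half_edges[OF fin_i le_k])
            have mult_K: "multiplicity_in (?F ` K) (f v) = multiplicity_in K v"
              if "v \<in> ?P - {i}" for v
              by (rule multiplicity_relabel[OF inj_i fst_half_edges[OF K] that])
            show ?case
              by (rule arg_cong[where f = return_pmf],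
                  rule availabilities_relabel[where f = f and g = g])
                (use fin inj_i inj_j avail_p avail_m mult_H mult_K remove_j in simp_all)
          qed
        qed
      qed
    qed
  qed
qed

text \<open>
  The law of the next measures is a function of the current measures alone, since states with equal
  measures differ by a relabelling of each side. This is the lumpability condition that makes
  \<^const>\<open>availabilities\<close> turn a Markov chain into a Markov chain, whatever the initial law.
\<close>

lemma step_lumpable:
  assumes "local_matching_criterion n \<Phi>" and "admissible n (Suc r) s" and "admissible n (Suc r) s'"
    and "availabilities s' = availabilities s"
  shows "map_pmf availabilities (step \<Phi> s') = map_pmf availabilities (step \<Phi> s)"
proof -
  have fin: "finite (undet_pos s)" "finite (undet_neg s)"
    "finite (undet_pos s')" "finite (undet_neg s')"
    using assms(2,3) by (auto simp: admissible_def)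
  have meas: "avail_measure (undet_pos s) (avail_pos s) = avail_measure (undet_pos s') (avail_pos s')"
    "avail_measure (undet_neg s) (avail_neg s) = avail_measure (undet_neg s') (avail_neg s')"
    using assms(4) by (auto simp: availabilities_def)
  obtain f where f: "bij_betw f (undet_pos s) (undet_pos s')"
    "\<And>v. v \<in> undet_pos s \<Longrightarrow> avail_pos s' (f v) = avail_pos s v"
    using avail_measure_eqD[OF fin(1,3) meas(1)] by blast
  obtain g where g: "bij_betw g (undet_neg s) (undet_neg s')"
    "\<And>v. v \<in> undet_neg s \<Longrightarrow> avail_neg s' (g v) = avail_neg s v"
    using avail_measure_eqD[OF fin(2,4) meas(2)] by blast
  show ?thesis
    using f g by (intro step_relabel[OF assms(1,2), where f = f and g = g]) (auto simp: bij_betw_def)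
qed

section \<open>The trajectory\<close>

lemma run_nth_0: "\<omega> \<in> set_pmf (run \<Phi> k s) \<Longrightarrow> \<omega> ! 0 = s"
  by (cases k) auto

lemma admissible_run:
  assumes "local_matching_criterion n \<Phi>"
  shows "admissible n (r + k) s \<Longrightarrow> \<omega> \<in> set_pmf (run \<Phi> k s) \<Longrightarrow> t \<le> k \<Longrightarrow>
    admissible n (r + k - t) (\<omega> ! t)"
proof (induction k arbitrary: s \<omega> t)
  case 0
  then show ?case by simp
next
  case (Suc k)
  then obtain s' \<omega>' where *: "s' \<in> set_pmf (step \<Phi> s)" "\<omega>' \<in> set_pmf (run \<Phi> k s')" "\<omega> = s # \<omega>'"
    by auto
  have "admissible n (r + k) s'"
    using admissible_step[OF assms _ *(1)] Suc.prems(1) by simp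
  then show ?case
    using Suc.IH[OF _ *(2)] Suc.prems *(3) by (cases t) auto
qed

text \<open>
  The Markov property of the chain of states itself, as a description of the joint law of
  the history up to time \<open>t\<close> and the next state.
\<close>

lemma run_next:
  assumes "t < k"
  shows "map_pmf (\<lambda>\<omega>. (take (Suc t) \<omega>, \<omega> ! Suc t)) (run \<Phi> k s) =
    do { \<omega> \<leftarrow> run \<Phi> k s; s' \<leftarrow> step \<Phi> (\<omega> ! t); return_pmf (take (Suc t) \<omega>, s') }"
  using assms
proof (induction k arbitrary: s t)
  case 0
  then show ?case by simp
next
  case (Suc k)
  show ?case
  proof (cases t)
    case 0
    have "map_pmf (\<lambda>\<omega>. ([s], \<omega> ! 0)) (run \<Phi> k s') = return_pmf ([s], s')" for s'
    proof -
      have "map_pmf (\<lambda>\<omega>. ([s], \<omega> ! 0)) (run \<Phi> k s') = map_pmf (\<lambda>_. ([s], s')) (run \<Phi> k s')"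
        by (rule map_pmf_cong[OF refl]) (simp add: run_nth_0)
      then show ?thesis by simp
    qed
    then show ?thesis
      using 0 by (simp add: map_bind_pmf bind_assoc_pmf bind_return_pmf map_pmf_def[symmetric]
          map_pmf_comp bind_map_pmf)
  next
    case (Suc u)
    then have u: "u < k"
      using Suc.prems by simp
    have "map_pmf (\<lambda>\<omega>. (take (Suc t) (s # \<omega>), (s # \<omega>) ! Suc t)) (run \<Phi> k s') =
        do { \<omega> \<leftarrow> run \<Phi> k s'; z \<leftarrow> step \<Phi> (\<omega> ! u); return_pmf (s # take (Suc u) \<omega>, z) }" for s'
    proof -
      have "map_pmf (\<lambda>\<omega>. (take (Suc t) (s # \<omega>), (s # \<omega>) ! Suc t)) (run \<Phi> k s') =
          map_pmf (map_prod (Cons s) id) (map_pmf (\<lambda>\<omega>. (take (Suc u) \<omega>, \<omega> ! Suc u)) (run \<Phi> k s'))"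
        using Suc by (simp add: map_pmf_comp)
      then show ?thesis
        by (simp add: Suc.IH[OF u] map_bind_pmf)
    qed
    then show ?thesis
      using Suc by (simp add: map_bind_pmf bind_assoc_pmf bind_return_pmf map_pmf_def[symmetric]
          map_pmf_comp bind_map_pmf)
  qed
qed

section \<open>Lumping and the Markov property\<close>

text \<open>
  If the kernel gives \<open>B\<close> the same mass \<open>c\<close> from every point satisfying \<open>Q\<close>, then on the
  event \<open>Q\<close> the passage to \<open>B\<close> just contributes a factor \<open>c\<close>.
\<close>

lemma prob_bind_const:
  assumes "\<And>x. x \<in> set_pmf p \<Longrightarrow> Q x \<Longrightarrow> measure_pmf.prob (K x) B = c"
  shows "measure_pmf.prob (do { x \<leftarrow> p; z \<leftarrow> K x; return_pmf (x, z) }) {(x, z). Q x \<and> z \<in> B} =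
    measure_pmf.prob p {x. Q x} * c"
proof (cases "\<exists>x\<in>set_pmf p. Q x")
  case False
  then show ?thesis
    by (subst measure_pmf_zero_iff[THEN iffD2], force)+ simp
next
  case True
  then have "0 \<le> c"
    using assms measure_nonneg by metis
  have "emeasure (measure_pmf (do { x \<leftarrow> p; z \<leftarrow> K x; return_pmf (x, z) })) {(x, z). Q x \<and> z \<in> B} =
      (\<integral>\<^sup>+ x. ennreal c * indicator {x. Q x} x \<partial>p)"
    unfolding emeasure_bind_pmf
  proof (rule nn_integral_cong_AE, unfold AE_measure_pmf_iff, rule ballI)
    fix x assume "x \<in> set_pmf p"
    have "emeasure (map_pmf (Pair x) (K x)) {(x, z). Q x \<and> z \<in> B} =
        ennreal c * indicator {x. Q x} x"
    proof (cases "Q x")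
      case True
      then have "Pair x -` {(x, z). Q x \<and> z \<in> B} = B"
        by auto
      then show ?thesis
        using True assms[OF \<open>x \<in> set_pmf p\<close>] by (simp add: measure_pmf.emeasure_eq_measure)
    qed simp
    then show "(\<integral>\<^sup>+ z. emeasure (return_pmf (x, z)) {(x, z). Q x \<and> z \<in> B} \<partial>K x) =
        ennreal c * indicator {x. Q x} x"
      unfolding map_pmf_def emeasure_bind_pmf .
  qed
  also have "\<dots> = ennreal c * emeasure p {x. Q x}"
    by (simp add: nn_integral_cmult)
  finally show ?thesis
    using \<open>0 \<le> c\<close>
    by (simp add: measure_pmf.emeasure_eq_measure ennreal_mult'[symmetric] mult.commute)
qed

lemma admissible_construction:
  assumes "local_matching_criterion n \<Phi>"
    and "measure_pmf.prob (sample_law n \<xi>p \<xi>m) (balanced n) > 0"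
    and "\<omega> \<in> set_pmf (construction_law n \<Phi> \<xi>p \<xi>m)" and "t \<le> n"
  shows "admissible n (n - t) (\<omega> ! t)"
proof -
  have "set_pmf (sample_law n \<xi>p \<xi>m) \<inter> balanced n \<noteq> {}"
    using assms(2) by (metis measure_pmf_zero_iff order_less_irrefl)
  then obtain dp dm where bal: "(dp, dm) \<in> balanced n"
    and \<omega>: "\<omega> \<in> set_pmf (run \<Phi> n (initial_state n dp dm))"
    using assms(3) by (auto simp: construction_law_def set_cond_pmf)
  have "admissible n (0 + n) (initial_state n dp dm)"
    using bal by (simp add: admissible_def initial_state_def balanced_def)
  from admissible_run[OF assms(1) this \<omega> assms(4)] show ?thesis
    by simp
qed

lemma construction_next:
  assumes "t < n"
  shows "map_pmf (\<lambda>\<omega>. (take (Suc t) \<omega>, \<omega> ! Suc t)) (construction_law n \<Phi> \<xi>p \<xi>m) =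
    do {
      h \<leftarrow> map_pmf (take (Suc t)) (construction_law n \<Phi> \<xi>p \<xi>m);
      s' \<leftarrow> step \<Phi> (h ! t);
      return_pmf (h, s')
    }"
  by (simp add: construction_law_def map_bind_pmf bind_map_pmf bind_assoc_pmf case_prod_beta'
      run_next[OF assms])

text \<open>
  The event \<open>Q\<close> may be any event of the past that fixes the current measures. The transition
  factor on the right does not depend on the choice of \<open>Q\<close>, only on the measures it fixes;
  the state \<open>s\<close> is any representative of them.
\<close>

lemma prob_next_availabilities:
  fixes n :: nat and \<Phi> :: "nat list \<Rightarrow> nat" and \<xi>p \<xi>m :: "nat pmf"
  defines "p \<equiv> construction_law n \<Phi> \<xi>p \<xi>m"
  assumes crit: "local_matching_criterion n \<Phi>"
    and pos: "measure_pmf.prob (sample_law n \<xi>p \<xi>m) (balanced n) > 0"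
    and "t < n" and "admissible n (n - t) s"
    and Q: "\<And>h. Q h \<Longrightarrow> availabilities (h ! t) = availabilities s"
  shows "measure_pmf.prob p {\<omega>. Q (take (Suc t) \<omega>) \<and> availabilities (\<omega> ! Suc t) = y} =
    measure_pmf.prob p {\<omega>. Q (take (Suc t) \<omega>)} * pmf (map_pmf availabilities (step \<Phi> s)) y"
proof -
  let ?q = "map_pmf (take (Suc t)) p"
  let ?B = "{z. availabilities z = y}"
  have same: "measure_pmf.prob (step \<Phi> (h ! t)) ?B = pmf (map_pmf availabilities (step \<Phi> s)) y"
    if "h \<in> set_pmf ?q" "Q h" for h
  proof -
    obtain \<omega> where \<omega>: "\<omega> \<in> set_pmf p" "h = take (Suc t) \<omega>"
      using \<open>h \<in> set_pmf ?q\<close> by auto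
    have "admissible n (n - t) (h ! t)"
      using admissible_construction[OF crit pos, of \<omega> t] \<omega> \<open>t < n\<close> by (simp add: p_def)
    then have "map_pmf availabilities (step \<Phi> (h ! t)) = map_pmf availabilities (step \<Phi> s)"
      using step_lumpable[OF crit, of "n - Suc t" s "h ! t"] \<open>admissible n (n - t) s\<close> \<open>t < n\<close>
        Q[OF \<open>Q h\<close>] by (simp add: Suc_diff_Suc)
    moreover have "measure_pmf.prob (step \<Phi> (h ! t)) ?B = pmf (map_pmf availabilities (step \<Phi> (h ! t))) y"
      by (simp add: pmf_map vimage_def)
    ultimately show ?thesis by simp
  qed
  have "measure_pmf.prob p {\<omega>. Q (take (Suc t) \<omega>) \<and> availabilities (\<omega> ! Suc t) = y} =
      measure_pmf.prob (map_pmf (\<lambda>\<omega>. (take (Suc t) \<omega>, \<omega> ! Suc t)) p) {(h, z). Q h \<and> z \<in> ?B}"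
    by (simp add: vimage_def)
  also have "\<dots> = measure_pmf.prob ?q {h. Q h} * pmf (map_pmf availabilities (step \<Phi> s)) y"
    unfolding p_def construction_next[OF \<open>t < n\<close>]
    by (rule prob_bind_const) (rule same[unfolded p_def])
  also have "measure_pmf.prob ?q {h. Q h} = measure_pmf.prob p {\<omega>. Q (take (Suc t) \<omega>)}"
    by (simp add: vimage_def)
  finally show ?thesis .
qed

theorem proposition2:
  fixes n :: nat and \<Phi> :: "nat list \<Rightarrow> nat" and \<xi>p \<xi>m :: "nat pmf"
  assumes "n > 0"
    and "local_matching_criterion n \<Phi>"
    and "measure_pmf.prob (sample_law n \<xi>p \<xi>m) (balanced n) > 0"
  shows "markov_process (construction_law n \<Phi> \<xi>p \<xi>m) n (\<lambda>t \<omega>. availabilities (\<omega> ! t))"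
  unfolding markov_process_def
proof (intro allI impI)
  fix t x y
  let ?p = "construction_law n \<Phi> \<xi>p \<xi>m"
  let ?past = "\<lambda>\<omega>. \<forall>i\<le>t. availabilities (\<omega> ! i) = x i"
  let ?present = "\<lambda>\<omega>. availabilities (\<omega> ! t) = x t"
  assume "t < n" and past: "\<P>(\<omega> in measure_pmf ?p. ?past \<omega>) > 0"
  then have "set_pmf ?p \<inter> {\<omega>. ?past \<omega>} \<noteq> {}"
    using measure_pmf_zero_iff[of ?p "{\<omega>. ?past \<omega>}"] by auto
  then obtain \<omega> where \<omega>: "\<omega> \<in> set_pmf ?p" "?past \<omega>"
    by blast
  let ?c = "pmf (map_pmf availabilities (step \<Phi> (\<omega> ! t))) y"
  have adm: "admissible n (n - t) (\<omega> ! t)"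
    using admissible_construction[OF assms(2,3) \<omega>(1)] \<open>t < n\<close> by simp
  \<comment> \<open>Both conditionings are instances: the whole past of the measures, and their present value.\<close>
  have cond: "\<P>(\<omega> in measure_pmf ?p. availabilities (\<omega> ! Suc t) = y \<bar> Q (take (Suc t) \<omega>)) = ?c"
    if "\<And>h. Q h \<Longrightarrow> ?present h" "\<P>(\<omega> in measure_pmf ?p. Q (take (Suc t) \<omega>)) > 0" for Q
    using prob_next_availabilities[OF assms(2,3) \<open>t < n\<close> adm, of Q y] that \<omega>(2)
    by (simp add: cond_prob_def conj_commute)
  have "\<P>(\<omega> in measure_pmf ?p. ?past \<omega>) \<le> \<P>(\<omega> in measure_pmf ?p. ?present \<omega>)"
    by (intro measure_pmf.finite_measure_mono) auto
  then have "\<P>(\<omega> in measure_pmf ?p. ?present \<omega>) > 0"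
    using past by simp
  then have "\<P>(\<omega> in measure_pmf ?p. availabilities (\<omega> ! Suc t) = y \<bar> ?present \<omega>) = ?c"
    using cond[of ?present] by simp
  moreover have "\<P>(\<omega> in measure_pmf ?p. availabilities (\<omega> ! Suc t) = y \<bar> ?past \<omega>) = ?c"
    using cond[of ?past] past by simp
  ultimately show "\<P>(\<omega> in measure_pmf ?p. availabilities (\<omega> ! Suc t) = y \<bar> ?past \<omega>) =
      \<P>(\<omega> in measure_pmf ?p. availabilities (\<omega> ! Suc t) = y \<bar> ?present \<omega>)"
    by simp
qed

end
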